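(* Let $s\ge 0$, $m\ge 1$ and $p$ be integers with $m\ge p\ge 0$. Let $f(z)=\sum_{n\ge 0}a_{mn+p}z^{mn+p}$ be a bounded analytic function in the unit disk $\mathbb{D}$, and let $r\ge 0$ satisfy $$\frac{m(s-1)+p}{ms+p}\le r^{2m}\le \frac{ms+p}{m(s+1)+p}.$$ Then $$S_rf\le \pi\,(ms+p)\,r^{2(ms+p)}\,\|f\|_\infty^2 .$$ The functions $f(z)=Cz^{ms+p}$, $C\in\mathbb{C}$, are extremal, i.e. they give equality.
   Context: $\mathbb{D}=\{z\in\mathbb{C}:|z|<1\}$ and $\|f\|_\infty=\sup_{z\in\mathbb{D}}|f(z)|$. For $f(z)=\sum_{n\ge0}a_nz^n$ analytic in $\mathbb{D}$ and $0\le r<1$, the area functional (area of $f(r\mathbb{D})$ counted with multiplicity) is $$S_rf=\int_{r\mathbb{D}}|f'(z)|^2\,dx\,dy=\pi\sum_{n\ge1}n|a_n|^2r^{2n}.$$ When $s=0$ and $p=0$ the left-hand inequality in the condition on $r^{2m}$ is read as imposing no restriction. *)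

theory Defs
  imports "HOL-Complex_Analysis.Complex_Analysis"
begin

definition sup_norm_disk :: "(complex \<Rightarrow> complex) \<Rightarrow> real" where
  "sup_norm_disk f = (SUP z\<in>ball 0 1. norm (f z))"

text \<open>On the complex numbers, \<^term>\<open>lborel\<close> is planar Lebesgue measure. For \<open>f\<close> analytic in the
  unit disk and \<open>r < 1\<close> the integrand below is continuous and bounded on the disk of radius \<open>r\<close>,
  so the convention that a non-integrable function has integral 0 plays no role there.\<close>

definition area_functional :: "real \<Rightarrow> (complex \<Rightarrow> complex) \<Rightarrow> real" where
  "area_functional r f = (LINT z:ball 0 r|lborel. (norm (deriv f z))\<^sup>2)"

definition bounded_gap_analytic :: "nat \<Rightarrow> nat \<Rightarrow> (complex \<Rightarrow> complex) \<Rightarrow> bool" where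
  "bounded_gap_analytic m p f \<longleftrightarrow>
     f holomorphic_on ball 0 1 \<and> bounded (f ` ball 0 1) \<and>
     (\<exists>a :: nat \<Rightarrow> complex. \<forall>z\<in>ball 0 1.
        (\<lambda>n. a (m * n + p) * z ^ (m * n + p)) sums f z)"

end

theory Submission imports Defs begin

text \<open>In terms of the Taylor coefficients \<open>c\<^sub>n\<close> of \<open>f\<close>, the area is
  \<open>pi * (\<Sum>n. n * r ^ (2 * n) * \<bar>c\<^sub>n\<bar>\<^sup>2)\<close>, and the two-sided condition on \<open>r ^ (2 * m)\<close> says
  precisely that, among the exponents \<open>n = m * k + p\<close> that occur, the weight \<open>n * r ^ (2 * n)\<close>
  increases up to \<open>k = s\<close> and decreases from there. The bound then follows from
  \<open>(\<Sum>n. \<bar>c\<^sub>n\<bar>\<^sup>2) \<le> \<parallel>f\<parallel>\<^sup>2\<close>. This last inequality is also obtained from area integrals: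
  integrate \<open>\<bar>z ^ K * f z\<bar>\<^sup>2\<close> over a disk and let \<open>K\<close> tend to infinity, so that the mass
  concentrates at the boundary circle.\<close>

section \<open>Rotation invariance of planar Lebesgue measure\<close>

text \<open>Lebesgue measure is determined by its values on boxes, and a complex box is the image of
  a product of two intervals. This moves the rotation argument to real pairs, where Fubini
  applies.\<close>

lemma lborel_complex_eq_distr_prod:
  "(lborel :: complex measure) = distr (lborel \<Otimes>\<^sub>M lborel) borel (\<lambda>(x, y). Complex x y)"
proof (rule lborel_eqI)
  have [measurable]: "(\<lambda>(x, y). Complex x y) \<in> borel_measurable (borel \<Otimes>\<^sub>M borel)"
    unfolding Complex_eq by measurable
  fix l u :: complex
  assume le: "\<And>b. b \<in> Basis \<Longrightarrow> l \<bullet> b \<le> u \<bullet> b"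
  have "(\<lambda>(x, y). Complex x y) -` box l u = {Re l<..<Re u} \<times> {Im l<..<Im u}"
    by (auto simp: box_def Basis_complex_def)
  then show "emeasure (distr (lborel \<Otimes>\<^sub>M lborel) borel (\<lambda>(x, y). Complex x y)) (box l u)
      = (\<Prod>b\<in>Basis. (u - l) \<bullet> b)"
    using le[of 1] le[of \<i>]
    by (subst emeasure_distr)
      (auto simp: space_pair_measure lborel.emeasure_pair_measure_Times Basis_complex_def
        ennreal_mult')
qed simp

lemma emeasure_lborel_vimage_plus:
  fixes c :: "'a::euclidean_space"
  assumes "A \<in> sets borel"
  shows "emeasure lborel ((\<lambda>x. x + c) -` A) = emeasure lborel A"
proof -
  have "emeasure lborel A = emeasure (distr lborel borel ((+) c)) A"
    by (simp add: lborel_distr_plus)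
  also have "\<dots> = emeasure lborel ((\<lambda>x. x + c) -` A)"
    using assms by (subst emeasure_distr) (auto simp: add.commute[of c] intro!: arg_cong[where f = "emeasure lborel"])
  finally show ?thesis ..
qed

text \<open>On each horizontal line the shear is a translation by the constant \<open>c * y\<close>,
  which preserves length. Integrating the slice lengths over \<open>y\<close> gives the
  claim.\<close>

lemma distr_lborel_shear_fst:
  "distr (lborel \<Otimes>\<^sub>M lborel) (borel \<Otimes>\<^sub>M borel) (\<lambda>(x, y). (x + c * y, y))
    = (lborel \<Otimes>\<^sub>M lborel :: (real \<times> real) measure)" (is "?L = ?R")
proof (rule measure_eqI)
  show "sets ?L = sets ?R"
    by (simp cong: sets_pair_measure_cong)
  fix X assume "X \<in> sets ?L"
  then have X [measurable]: "X \<in> sets (lborel \<Otimes>\<^sub>M lborel)"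
    by (simp cong: sets_pair_measure_cong)
  have X': "X \<in> sets (borel \<Otimes>\<^sub>M borel)"
    using X by (simp cong: sets_pair_measure_cong)
  let ?V = "(\<lambda>(x, y). (x + c * y, y)) -` X"
  have V: "?V \<in> sets (lborel \<Otimes>\<^sub>M lborel)"
    using measurable_sets[of "\<lambda>(x, y). (x + c * y, y)" "lborel \<Otimes>\<^sub>M lborel" "borel \<Otimes>\<^sub>M borel" X] X'
    by (simp add: space_pair_measure)
  have "emeasure ?L X = emeasure ?R ?V"
    using X' by (subst emeasure_distr) (auto simp: space_pair_measure)
  also have "\<dots> = (\<integral>\<^sup>+y. emeasure lborel ((\<lambda>x. x + c * y) -` ((\<lambda>x. (x, y)) -` X)) \<partial>lborel)"
    by (subst lborel_pair.emeasure_pair_measure_alt2[OF V])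
      (intro nn_integral_cong arg_cong[where f = "emeasure lborel"], auto)
  also have "\<dots> = (\<integral>\<^sup>+y. emeasure lborel ((\<lambda>x. (x, y)) -` X) \<partial>lborel)"
    by (intro nn_integral_cong emeasure_lborel_vimage_plus)
      (use X in \<open>auto intro: sets_Pair2\<close>)
  also have "\<dots> = emeasure ?R X"
    by (rule lborel_pair.emeasure_pair_measure_alt2[OF X, symmetric])
  finally show "emeasure ?L X = emeasure ?R X" .
qed

text \<open>A vertical shear is a horizontal one conjugated by the coordinate swap, which also
  preserves the product measure.\<close>

lemma distr_lborel_shear_snd:
  "distr (lborel \<Otimes>\<^sub>M lborel) (borel \<Otimes>\<^sub>M borel) (\<lambda>(x, y). (x, y + c * x))
    = (lborel \<Otimes>\<^sub>M lborel :: (real \<times> real) measure)" (is "?L = ?R")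
proof -
  let ?swap = "\<lambda>(x, y). (y, x) :: real \<times> real" and ?N = "borel \<Otimes>\<^sub>M borel :: (real \<times> real) measure"
  have swap: "distr ?R ?N ?swap = ?R"
    using lborel_pair.distr_pair_swap[where 'a = real and 'b = real]
    by (simp cong: distr_cong sets_pair_measure_cong)
  have "?L = distr (distr (distr ?R ?N ?swap) ?N (\<lambda>(x, y). (x + c * y, y))) ?N ?swap"
    by (simp add: distr_distr comp_def case_prod_beta' cong: measurable_cong_sets)
  also have "\<dots> = ?R"
    by (simp only: swap distr_lborel_shear_fst)
  finally show ?thesis .
qed

text \<open>A rotation by an angle \<open>t\<close> with \<open>\<bar>t\<bar> < pi\<close> is a product of three shears, with
  parameters \<open>- tan (t / 2)\<close>, \<open>sin t\<close> and \<open>- tan (t / 2)\<close>.\<close>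
lemma distr_lborel_cis:
  assumes "cos (t / 2) \<noteq> 0"
  shows "distr lborel borel ((*) (cis t)) = (lborel :: complex measure)"
proof -
  let ?R = "lborel \<Otimes>\<^sub>M lborel :: (real \<times> real) measure"
    and ?N = "borel \<Otimes>\<^sub>M borel :: (real \<times> real) measure"
  define a where "a = - tan (t / 2)"
  define b where "b = sin t"
  have st: "sin t = 2 * sin (t / 2) * cos (t / 2)" "cos t = 1 - 2 * (sin (t / 2))\<^sup>2"
    using sin_double[of "t / 2"] cos_double_sin[of "t / 2"] by simp_all
  \<comment> \<open>The composition of the three shears has diagonal entries
    \<open>1 + a * b\<close>, lower left entry \<open>b\<close> and upper right entry
    \<open>a * (1 + a * b) + a\<close>. The facts \<open>ab\<close> and \<open>ab2\<close> identify
    these with the entries of the rotation matrix.\<close>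
  have ab: "1 + a * b = cos t"
  proof -
    have "a * b = - (2 * (sin (t / 2))\<^sup>2)"
      using assms unfolding a_def b_def st(1) tan_def by (simp add: power2_eq_square)
    then show ?thesis
      using st(2) by simp
  qed
  have ab2: "a * cos t + a = - sin t"
  proof -
    have "a * cos t + a = - tan (t / 2) * (2 - 2 * (sin (t / 2))\<^sup>2)"
      unfolding st(2) a_def by (simp add: algebra_simps)
    also have "\<dots> = - tan (t / 2) * (2 * (cos (t / 2))\<^sup>2)"
      by (simp add: cos_squared_eq)
    also have "\<dots> = - sin t"
      using assms unfolding st(1) tan_def by (simp add: power2_eq_square)
    finally show ?thesis .
  qed
  define F G where "F = (\<lambda>(x, y). (x + a * y, y :: real))"
    and "G = (\<lambda>(x, y). (x :: real, y + b * x))"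
  have [measurable]: "(\<lambda>(x, y). Complex x y) \<in> borel_measurable ?N"
      "F \<in> ?N \<rightarrow>\<^sub>M ?N" "G \<in> ?N \<rightarrow>\<^sub>M ?N"
    unfolding Complex_eq F_def G_def by measurable
  have RN: "sets ?R = sets ?N"
    by (simp cong: sets_pair_measure_cong)
  have eq: "cis t * Complex x y = (\<lambda>(x, y). Complex x y) (F (G (F (x, y))))" for x y
  proof -
    have "x + a * y + a * (y + b * (x + a * y)) = (1 + a * b) * x + (a * (1 + a * b) + a) * y"
      "y + b * (x + a * y) = (1 + a * b) * y + b * x"
      by (simp_all add: algebra_simps)
    then show ?thesis
      unfolding ab ab2 by (simp add: F_def G_def complex_eq_iff b_def)
  qed
  have inv: "distr ?R ?N F = ?R" "distr ?R ?N G = ?R"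
    unfolding F_def G_def by (rule distr_lborel_shear_fst distr_lborel_shear_snd)+
  have "distr lborel borel ((*) (cis t))
      = distr ?R borel (\<lambda>(x, y). cis t * Complex x y)"
    by (subst lborel_complex_eq_distr_prod, subst distr_distr)
      (auto simp: comp_def case_prod_beta' cong: measurable_cong_sets)
  also have "\<dots> = distr (distr (distr (distr ?R ?N F) ?N G) ?N F) borel (\<lambda>(x, y). Complex x y)"
    by (simp add: distr_distr comp_def eq case_prod_beta' cong: measurable_cong_sets)
  also have "\<dots> = lborel"
    by (simp only: inv lborel_complex_eq_distr_prod[symmetric])
  finally show ?thesis .
qed

section \<open>Power series on disks\<close>

lemma set_integrable_disk:
  fixes h :: "complex \<Rightarrow> 'a::{banach, second_countable_topology}"
  assumes "continuous_on (cball 0 r) h"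
  shows "set_integrable lborel (ball 0 r) h"
proof (rule set_integrable_subset)
  show "set_integrable lborel (cball 0 r) h"
    using assms by (auto simp: set_integrable_def intro!: borel_integrable_compact)
qed auto

text \<open>Change of variables by a rotation, which preserves both the measure and the centred
  disk.\<close>

lemma disk_integral_mult_unimodular:
  fixes h :: "complex \<Rightarrow> complex"
  assumes "cos (t / 2) \<noteq> 0" and [measurable]: "h \<in> borel_measurable borel"
  shows "(LINT z:ball 0 r|lborel. h (cis t * z)) = (LINT z:ball 0 r|lborel. h z)"
proof -
  have "(LINT z:ball 0 r|lborel. h z)
      = (LINT z:ball 0 r|distr lborel borel ((*) (cis t)). h z)"
    by (simp add: distr_lborel_cis[OF assms(1)])
  also have "\<dots> = (LINT z:ball 0 r|lborel. h (cis t * z))"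
    unfolding set_lebesgue_integral_def
    by (subst integral_distr) (auto simp: indicator_def norm_mult)
  finally show ?thesis ..
qed

text \<open>Rotating by \<open>t\<close> multiplies the integrand by the constant
  \<open>w = cis ((j - k) * t)\<close>, so the integral equals \<open>w\<close> times itself. It
  must vanish as soon as \<open>w\<close> differs from 1.\<close>

lemma disk_integral_monomials_orthogonal:
  assumes "j \<noteq> k"
  shows "(LINT z:ball 0 r|lborel. z ^ j * cnj z ^ k) = 0" (is "?I = 0")
proof -
  \<comment> \<open>This angle makes \<open>(j - k) * t\<close> nonzero and at most 1 in absolute
    value, hence below \<open>pi\<close>, so its sine is nonzero and \<open>w\<close> is not 1. Also
    \<open>t\<close> is at most 1, which gives \<open>cos (t / 2) > 0\<close>.\<close>
  define t :: real where "t = 1 / real (j + k)"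
  define w where "w = cis (real j * t - real k * t)"
  have jk: "real (j + k) \<ge> 1"
    using assms by linarith
  then have t: "0 < t" "t \<le> 1" "(real j + real k) * t = 1"
    by (auto simp: t_def)
  then have jkt: "real j * t + real k * t = 1"
    by (simp add: algebra_simps)
  have nonneg: "0 \<le> real j * t" "0 \<le> real k * t"
    using t by auto
  have "cos (t / 2) > 0"
    using t pi_gt3 by (intro cos_gt_zero_pi) auto
  then have "?I = (LINT z:ball 0 r|lborel. (cis t * z) ^ j * cnj (cis t * z) ^ k)"
    by (intro disk_integral_mult_unimodular[symmetric, where h = "\<lambda>z. z ^ j * cnj z ^ k"])
      (auto intro!: borel_measurable_continuous_onI continuous_intros)
  also have "\<dots> = (LINT z:ball 0 r|lborel. w * (z ^ j * cnj z ^ k))"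
  proof -
    have "w = cis t ^ j * cnj (cis t) ^ k"
      by (simp only: w_def cis_cnj Complex.DeMoivre cis_mult) (simp add: algebra_simps)
    then show ?thesis
      by (simp add: power_mult_distrib mult_ac)
  qed
  also have "\<dots> = w * ?I"
    by (rule set_integral_mult_right)
  finally have "w = 1 \<or> ?I = 0"
    by auto
  moreover have "w \<noteq> 1"
  proof
    assume "w = 1"
    then have "sin (real j * t - real k * t) = 0"
      by (simp add: w_def complex_eq_iff)
    moreover have "real j * t - real k * t \<noteq> 0"
      using t assms by simp
    moreover have "\<bar>real j * t - real k * t\<bar> < pi"
      using nonneg jkt pi_gt3 by linarith
    ultimately show False
      using sin_zero_pi_iff[of "real j * t - real k * t"] by blast
  qed
  ultimately show ?thesis by blast
qed

text \<open>Layer-cake computation: \<open>norm z ^ (2 * k)\<close> is the integral of its radial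
  derivative \<open>g\<close> over \<open>{0..norm z}\<close>. Exchanging the integrals leaves a
  one-dimensional integral of \<open>g t\<close> times the area of the annulus between the radii
  \<open>t\<close> and \<open>r\<close>.\<close>

lemma disk_integral_norm_power:
  assumes "0 \<le> r"
  shows "(LINT z:ball (0::complex) r|lborel. norm z ^ (2 * k)) = pi * r ^ (2 * k + 2) / real (k + 1)"
proof (cases "k = 0")
  \<comment> \<open>The layer formula fails for exponent 0, because \<open>0 ^ 0 = 1\<close> would
    be subtracted at the lower end; here the integral is simply the area of the disk.\<close>
  case True
  then show ?thesis
    using assms by (simp add: set_lebesgue_integral_def content_ball unit_ball_vol_2 power2_eq_square)
next
  case False
  define g where "g = (\<lambda>t::real. 2 * real k * t ^ (2 * k - 1))"
  have [measurable]: "g \<in> borel_measurable borel"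
    unfolding g_def by measurable
  have g0: "g t \<ge> 0" if "0 \<le> t" for t
    using that by (simp add: g_def)
  have primitive: "((\<lambda>t. t ^ (2 * k)) has_real_derivative g t) (at t)" for t
    unfolding g_def by (auto intro!: derivative_eq_intros)
  have layer: "ennreal (norm z ^ (2 * k)) = (\<integral>\<^sup>+t. ennreal (g t) * indicator {0..norm z} t \<partial>lborel)"
    for z :: complex
    by (subst nn_integral_FTC_Icc[where F = "\<lambda>t. t ^ (2 * k)"])
      (use False g0 primitive in auto)
  have annulus: "emeasure lborel {z::complex. t \<le> norm z \<and> norm z < r} = ennreal (pi * (r\<^sup>2 - t\<^sup>2))"
    if "0 \<le> t" "t \<le> r" for t
  proof -
    have "{z::complex. t \<le> norm z \<and> norm z < r} = ball 0 r - ball 0 t"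
      by auto
    then show ?thesis
      using that emeasure_Diff[of lborel "ball (0::complex) t" "ball 0 r"]
      by (simp add: emeasure_ball unit_ball_vol_2 ennreal_minus right_diff_distrib subset_ball)
  qed
  \<comment> \<open>Both pairs of indicators describe the region
    \<open>0 <= t <= norm z < r\<close>. The second form isolates the \<open>z\<close>-section for
    fixed \<open>t\<close>, which is an annulus.\<close>
  have "(\<integral>\<^sup>+z. ennreal (norm z ^ (2 * k)) * indicator (ball (0::complex) r) z \<partial>lborel)
      = (\<integral>\<^sup>+z. (\<integral>\<^sup>+t. ennreal (g t) * indicator {0..r} t
            * indicator {z::complex. t \<le> norm z \<and> norm z < r} z \<partial>lborel) \<partial>lborel)"
    unfolding layer
    by (subst nn_integral_multc[symmetric])
      (auto intro!: nn_integral_cong simp: indicator_def)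
  also have "\<dots> = (\<integral>\<^sup>+t. (\<integral>\<^sup>+z. ennreal (g t) * indicator {0..r} t
            * indicator {z::complex. t \<le> norm z \<and> norm z < r} z \<partial>lborel) \<partial>lborel)"
    by (rule lborel_pair.Fubini') measurable
  also have "\<dots> = (\<integral>\<^sup>+t. ennreal (g t * (pi * (r\<^sup>2 - t\<^sup>2))) * indicator {0..r} t \<partial>lborel)"
    by (intro nn_integral_cong, subst nn_integral_cmult)
      (auto simp: annulus g0 ennreal_mult' indicator_def)
  \<comment> \<open>The antiderivative comes from integrating
    \<open>2 * k * t ^ (2 * k - 1) * (r^2 - t^2)\<close> term by term. At \<open>r\<close> it leaves
    the factor \<open>1 - k / (k + 1) = 1 / (k + 1)\<close>, and at 0 it vanishes.\<close>
  also have "\<dots> = ennreal (pi * r ^ (2 * k + 2) / real (k + 1))"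
  proof (subst nn_integral_FTC_Icc[where
        F = "\<lambda>t. pi * (r\<^sup>2 * t ^ (2 * k) - real k / real (k + 1) * t ^ (2 * k + 2))"])
    fix t assume t: "t \<in> {0..r}"
    have "t\<^sup>2 * t ^ (2 * k - 1) = t ^ (2 * k + 1)"
      using False by (simp flip: power_add)
    moreover have "real k / real (k + 1) * real (2 * k + 2) = 2 * real k"
      by (simp add: field_simps)
    ultimately have eq: "pi * (r\<^sup>2 * g t - real k / real (k + 1) * (real (2 * k + 2) * t ^ (2 * k + 1)))
        = g t * (pi * (r\<^sup>2 - t\<^sup>2))"
      unfolding mult.assoc[symmetric] g_def by (simp add: algebra_simps)
    have power_deriv: "((\<lambda>t. t ^ (2 * k + 2)) has_real_derivative real (2 * k + 2) * t ^ (2 * k + 1)) (at t)"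
      using DERIV_pow[of "2 * k + 2" t UNIV] by simp
    have "((\<lambda>t. pi * (r\<^sup>2 * t ^ (2 * k) - real k / real (k + 1) * t ^ (2 * k + 2))) has_real_derivative
        pi * (r\<^sup>2 * g t - real k / real (k + 1) * (real (2 * k + 2) * t ^ (2 * k + 1)))) (at t)"
      by (intro DERIV_cmult DERIV_diff primitive power_deriv)
    with eq show "((\<lambda>t. pi * (r\<^sup>2 * t ^ (2 * k) - real k / real (k + 1) * t ^ (2 * k + 2)))
        has_real_derivative g t * (pi * (r\<^sup>2 - t\<^sup>2))) (at t)"
      by (simp only:)
    have "t\<^sup>2 \<le> r\<^sup>2"
      using t by (intro power_mono) auto
    then show "0 \<le> g t * (pi * (r\<^sup>2 - t\<^sup>2))"
      using t g0 by simp
  qed (use assms False in \<open>auto simp: field_simps power_add power2_eq_square power_0_left\<close>)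
  finally have "(\<integral>\<^sup>+z. ennreal (norm z ^ (2 * k)) * indicator (ball (0::complex) r) z \<partial>lborel)
      = ennreal (pi * r ^ (2 * k + 2) / real (k + 1))" .
  then show ?thesis
    unfolding set_lebesgue_integral_def
    by (intro integral_eq_nn_integral[THEN trans])
      (use assms in \<open>auto simp: ennreal_mult' mult_ac ennreal_indicator
          intro!: borel_measurable_times borel_measurable_indicator borel_measurable_power\<close>)
qed

text \<open>Expanding the square as a double sum, orthogonality removes every term off the
  diagonal.\<close>

lemma disk_integral_norm_poly:
  fixes d :: "nat \<Rightarrow> complex"
  assumes "0 \<le> r"
  shows "(LINT z:ball 0 r|lborel. (norm (\<Sum>n<N. d n * z ^ n))\<^sup>2)
    = (\<Sum>n<N. (norm (d n))\<^sup>2 * (pi * r ^ (2 * n + 2) / real (n + 1)))"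
proof -
  have moment: "(LINT z:ball 0 r|lborel. z ^ j * cnj z ^ k)
      = (if j = k then complex_of_real (pi * r ^ (2 * j + 2) / real (j + 1)) else 0)" for j k
  proof (cases "j = k")
    case True
    have "z ^ j * cnj z ^ j = complex_of_real ((norm z)\<^sup>2) ^ j" for z
      by (simp only: complex_norm_square power_mult_distrib)
    then have *: "z ^ j * cnj z ^ j = complex_of_real (norm z ^ (2 * j))" for z
      by (simp add: power_mult)
    show ?thesis
      unfolding True[symmetric] * set_integral_complex_of_real disk_integral_norm_power[OF assms]
      by simp
  qed (simp add: disk_integral_monomials_orthogonal)
  have int: "set_integrable lborel (ball 0 r) (\<lambda>z. d j * cnj (d k) * (z ^ j * cnj z ^ k))" for j k
    by (intro set_integrable_disk continuous_intros)
  have "complex_of_real (LINT z:ball 0 r|lborel. (norm (\<Sum>n<N. d n * z ^ n))\<^sup>2)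
      = (LINT z:ball 0 r|lborel. \<Sum>j<N. \<Sum>k<N. d j * cnj (d k) * (z ^ j * cnj z ^ k))"
    unfolding set_integral_complex_of_real[symmetric] complex_norm_square cnj_sum sum_product
    by (simp add: mult_ac)
  also have "\<dots> = (\<Sum>j<N. \<Sum>k<N. d j * cnj (d k) * (LINT z:ball 0 r|lborel. z ^ j * cnj z ^ k))"
    unfolding set_integral_mult_right[symmetric]
    using int unfolding set_lebesgue_integral_def set_integrable_def
    by (simp only: scaleR_sum_right Bochner_Integration.integral_sum Bochner_Integration.integrable_sum)
  also have "\<dots> = (\<Sum>j<N. complex_of_real ((norm (d j))\<^sup>2 * (pi * r ^ (2 * j + 2) / real (j + 1))))"
    unfolding moment by (simp add: complex_norm_square[symmetric] if_distrib cong: if_cong)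
  finally show ?thesis
    unfolding of_real_sum[symmetric] of_real_eq_iff .
qed

text \<open>The polynomial identity passes to the limit by dominated convergence: absolute
  convergence at radius \<open>r\<close> bounds all partial sums on the disk by one constant
  \<open>B\<close>.\<close>

lemma disk_integral_norm_power_series:
  fixes h :: "complex \<Rightarrow> complex"
  assumes r: "0 \<le> r" "r < 1"
    and h: "\<And>z. norm z < 1 \<Longrightarrow> (\<lambda>n. d n * z ^ n) sums h z"
  shows "(\<lambda>n. (norm (d n))\<^sup>2 * (pi * r ^ (2 * n + 2) / real (n + 1)))
    sums (LINT z:ball 0 r|lborel. (norm (h z))\<^sup>2)"
proof -
  \<comment> \<open>The midpoint of \<open>r\<close> and 1 is a point of convergence strictly
    outside radius \<open>r\<close>, which yields absolute convergence at \<open>r\<close>.\<close>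
  have "norm (complex_of_real ((1 + r) / 2)) < 1"
    using r unfolding norm_of_real by simp
  then have outer: "summable (\<lambda>n. d n * complex_of_real ((1 + r) / 2) ^ n)"
    by (rule sums_summable[OF h])
  have "norm (complex_of_real r) < norm (complex_of_real ((1 + r) / 2))"
    using r unfolding norm_of_real by simp
  from powser_insidea[OF outer this] have summ: "summable (\<lambda>n. norm (d n) * r ^ n)"
    using r by (simp add: norm_mult norm_power)
  define B where "B = (\<Sum>n. norm (d n) * r ^ n)"
  have bound: "norm (\<Sum>n<N. d n * z ^ n) \<le> B" if "norm z < r" for z N
  proof -
    have "norm (\<Sum>n<N. d n * z ^ n) \<le> (\<Sum>n<N. norm (d n) * r ^ n)"
      using that by (intro sum_norm_le) (auto simp: norm_mult norm_power intro!: mult_left_mono power_mono)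
    also have "\<dots> \<le> B"
      unfolding B_def using r by (intro sum_le_suminf summ) auto
    finally show ?thesis .
  qed
  have lim: "(\<lambda>N. indicator (ball 0 r) z *\<^sub>R (norm (\<Sum>n<N. d n * z ^ n))\<^sup>2)
      \<longlonglongrightarrow> indicator (ball 0 r) z *\<^sub>R (norm (h z))\<^sup>2" for z
  proof (cases "norm z < r")
    case True
    then show ?thesis
      using h[of z] r unfolding sums_def by (intro tendsto_intros) auto
  qed (simp add: indicator_def)
  have "(\<lambda>N. LINT z:ball 0 r|lborel. (norm (\<Sum>n<N. d n * z ^ n))\<^sup>2)
      \<longlonglongrightarrow> (LINT z:ball 0 r|lborel. (norm (h z))\<^sup>2)"
    unfolding set_lebesgue_integral_def
  proof (rule integral_dominated_convergence[where w = "\<lambda>z. indicator (ball 0 r) z *\<^sub>R B\<^sup>2"])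
    show meas: "(\<lambda>z. indicator (ball 0 r) z *\<^sub>R (norm (\<Sum>n<N. d n * z ^ n))\<^sup>2) \<in> borel_measurable lborel" for N
      by (intro borel_measurable_scaleR borel_measurable_indicator)
        (auto intro!: borel_measurable_continuous_onI continuous_intros)
    \<comment> \<open>Nothing is known about \<open>h\<close> outside the unit disk, so
      measurability of the cut-off function is taken from its being a pointwise limit.\<close>
    show "(\<lambda>z. indicator (ball 0 r) z *\<^sub>R (norm (h z))\<^sup>2) \<in> borel_measurable lborel"
      by (rule borel_measurable_LIMSEQ_real[OF lim meas])
    show "integrable lborel (\<lambda>z. indicator (ball (0::complex) r) z *\<^sub>R B\<^sup>2)"
      using set_integrable_disk[of r "\<lambda>_. B\<^sup>2"] by (simp add: set_integrable_def)
    show "AE z in lborel. norm (indicator (ball 0 r) z *\<^sub>R (norm (\<Sum>n<N. d n * z ^ n))\<^sup>2)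
        \<le> indicator (ball 0 r) z *\<^sub>R B\<^sup>2" for N
      using bound by (intro always_eventually) (auto simp: indicator_def intro!: power_mono)
  qed (rule always_eventually, rule allI, rule lim)
  then show ?thesis
    unfolding sums_def disk_integral_norm_poly[OF r(1)] .
qed

text \<open>For \<open>z ^ K * f z\<close>, the coefficient \<open>c n\<close> sits at index
  \<open>n + K\<close>. Its disk moment divided by that of \<open>z ^ K\<close> is
  \<open>r ^ (2 * n) * (K + 1) / (n + K + 1)\<close>, which tends to \<open>r ^ (2 * n)\<close> as
  \<open>K\<close> grows and then to 1 as \<open>r\<close> tends to 1. With \<open>N\<close> fixed,
  both limits are taken term by term.\<close>

lemma norm_bounded_imp_sum_coeffs_le:
  fixes f :: "complex \<Rightarrow> complex"
  assumes f: "\<And>z. norm z < 1 \<Longrightarrow> (\<lambda>n. c n * z ^ n) sums f z"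
    and M: "\<And>z. norm z < 1 \<Longrightarrow> norm (f z) \<le> M"
  shows "(\<Sum>n<N. (norm (c n))\<^sup>2) \<le> M\<^sup>2"
proof -
  have scaled: "(\<Sum>n<N. (norm (c n))\<^sup>2 * r ^ (2 * n) * (real (K + 1) / real (n + K + 1))) \<le> M\<^sup>2"
    if r: "0 < r" "r < 1" for r K
  proof -
    let ?I = "\<lambda>h :: complex \<Rightarrow> complex. LINT z:ball 0 r|lborel. (norm (h z))\<^sup>2"
    define d where "d n = (if n < K then 0 else c (n - K))" for n
    have d: "(\<lambda>n. d n * z ^ n) sums (z ^ K * f z)" if "norm z < 1" for z
    proof -
      have "(\<lambda>n. d (n + K) * z ^ (n + K)) sums (z ^ K * f z)"
        using sums_mult[OF f[OF that], of "z ^ K"] by (simp add: d_def power_add mult_ac)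
      moreover have "(\<Sum>n<K. d n * z ^ n) = 0"
        by (simp add: d_def)
      ultimately show ?thesis
        using sums_iff_shift[of "\<lambda>n. d n * z ^ n" K "z ^ K * f z"] by simp
    qed
    let ?a = "\<lambda>n. (norm (d n))\<^sup>2 * (pi * r ^ (2 * n + 2) / real (n + 1))"
    have S: "?a sums ?I (\<lambda>z. z ^ K * f z)"
      using disk_integral_norm_power_series[OF _ _ d] r by simp
    \<comment> \<open>Only a finite window of the nonnegative series is kept, so its sum is at most
      the integral.\<close>
    have "(\<Sum>n<N. ?a (n + K)) = sum ?a {K..<N + K}"
      using sum.shift_bounds_nat_ivl[of ?a 0 K N] by (simp add: lessThan_atLeast0)
    also have "\<dots> \<le> ?I (\<lambda>z. z ^ K * f z)"
      using S r by (subst sums_unique[OF S]) (intro sum_le_suminf, auto simp: sums_iff)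
    also have "\<dots> \<le> (LINT z:ball (0::complex) r|lborel. M\<^sup>2 * norm z ^ (2 * K))"
    proof (rule set_integral_mono)
      have "(\<lambda>z. z ^ K * f z) holomorphic_on ball 0 1"
        using d by (intro power_series_holomorphic[where a = d]) auto
      then show "set_integrable lborel (ball 0 r) (\<lambda>z. (norm (z ^ K * f z))\<^sup>2)"
        using r by (intro set_integrable_disk continuous_intros
            continuous_on_subset[OF holomorphic_on_imp_continuous_on]) auto
      show "set_integrable lborel (ball (0::complex) r) (\<lambda>z. M\<^sup>2 * norm z ^ (2 * K))"
        by (intro set_integrable_disk continuous_intros)
      fix z :: complex assume "z \<in> ball 0 r"
      then have "norm (f z) \<le> M"
        using M r by auto
      then have "(norm (f z))\<^sup>2 * norm z ^ (2 * K) \<le> M\<^sup>2 * norm z ^ (2 * K)"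
        by (intro mult_right_mono power_mono) auto
      then show "(norm (z ^ K * f z))\<^sup>2 \<le> M\<^sup>2 * norm z ^ (2 * K)"
        by (simp add: norm_mult norm_power power_mult_distrib power_mult[symmetric] mult_ac)
    qed
    also have "\<dots> = M\<^sup>2 * (pi * r ^ (2 * K + 2) / real (K + 1))"
      using r by (simp add: disk_integral_norm_power)
    finally have "(\<Sum>n<N. ?a (n + K)) * (real (K + 1) / (pi * r ^ (2 * K + 2))) \<le> M\<^sup>2"
      using r by (simp add: field_simps)
    then show ?thesis
      using r unfolding sum_distrib_right
      by (simp add: d_def power_add power2_eq_square divide_simps mult_ac power_mult)
  qed
  have "(\<Sum>n<N. (norm (c n))\<^sup>2 * r ^ (2 * n)) \<le> M\<^sup>2" if "0 < r" "r < 1" for r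
  proof (rule LIMSEQ_le_const2)
    have "(\<lambda>K. real (K + 1) / real (n + K + 1)) \<longlonglongrightarrow> 1" for n
      by real_asymp
    then have "(\<lambda>K. \<Sum>n<N. (norm (c n))\<^sup>2 * r ^ (2 * n) * (real (K + 1) / real (n + K + 1)))
        \<longlonglongrightarrow> (\<Sum>n<N. (norm (c n))\<^sup>2 * r ^ (2 * n) * 1)"
      by (intro tendsto_intros)
    then show "(\<lambda>K. \<Sum>n<N. (norm (c n))\<^sup>2 * r ^ (2 * n) * (real (K + 1) / real (n + K + 1)))
        \<longlonglongrightarrow> (\<Sum>n<N. (norm (c n))\<^sup>2 * r ^ (2 * n))"
      by simp
  qed (use scaled[OF that] in blast)
  \<comment> \<open>The radius now tends to 1 from below; the finite sum is continuous in
    \<open>r\<close>, so the bound survives.\<close>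
  then have "eventually (\<lambda>r. (\<Sum>n<N. (norm (c n))\<^sup>2 * r ^ (2 * n)) \<le> M\<^sup>2) (at_left 1)"
    using eventually_at_left_real[of 0 "1::real"] by (auto elim!: eventually_mono)
  moreover have "((\<lambda>r. \<Sum>n<N. (norm (c n))\<^sup>2 * r ^ (2 * n)) \<longlongrightarrow> (\<Sum>n<N. (norm (c n))\<^sup>2 * 1 ^ (2 * n)))
      (at_left (1::real))"
    by (intro tendsto_intros)
  ultimately show ?thesis
    using tendsto_upperbound[of _ _ "at_left (1::real)"] by fastforce
qed

text \<open>The derivative has coefficients \<open>(n + 1) * c (n + 1)\<close>. Squaring gives two
  factors \<open>n + 1\<close>, one of which cancels against the moment of \<open>z ^ n\<close>.
  Shifting the index back by one adds only a zero term.\<close>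

lemma area_functional_sums:
  assumes r: "0 \<le> r" "r < 1"
    and f: "\<And>z. norm z < 1 \<Longrightarrow> (\<lambda>n. c n * z ^ n) sums f z"
  shows "(\<lambda>n. pi * (real n * r ^ (2 * n) * (norm (c n))\<^sup>2)) sums area_functional r f"
proof -
  have deriv: "(\<lambda>n. diffs c n * z ^ n) sums deriv f z" if z: "norm z < 1" for z
  proof -
    have "((\<lambda>z. \<Sum>n. c n * z ^ n) has_field_derivative (\<Sum>n. diffs c n * z ^ n)) (at z)"
      by (rule termdiffs_strong'[of 1]) (use f z in \<open>auto simp: sums_iff\<close>)
    \<comment> \<open>The series represents \<open>f\<close> only inside the unit disk, so the
      derivative is transferred through equality near \<open>z\<close>.\<close>
    then have "(f has_field_derivative (\<Sum>n. diffs c n * z ^ n)) (at z)"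
      by (rule DERIV_cong_ev[THEN iffD1, rotated -1])
        (use f z in \<open>auto simp: sums_iff intro!: eventually_mono[OF eventually_nhds_in_open[of "ball 0 1"]]\<close>)
    moreover have "summable (\<lambda>n. diffs c n * z ^ n)"
      by (rule termdiff_converges[of _ 1]) (use f z in \<open>auto simp: sums_iff\<close>)
    ultimately show ?thesis
      by (simp add: DERIV_imp_deriv summable_sums)
  qed
  have "(\<lambda>n. (norm (diffs c n))\<^sup>2 * (pi * r ^ (2 * n + 2) / real (n + 1))) sums area_functional r f"
    unfolding area_functional_def by (rule disk_integral_norm_power_series[OF r deriv])
  moreover have "(norm (diffs c n))\<^sup>2 * (pi * r ^ (2 * n + 2) / real (n + 1))
      = pi * (real (Suc n) * r ^ (2 * Suc n) * (norm (c (Suc n)))\<^sup>2)" for n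
    by (simp add: diffs_def norm_mult power2_eq_square field_simps del: of_nat_Suc)
  ultimately have "(\<lambda>n. pi * (real (Suc n) * r ^ (2 * Suc n) * (norm (c (Suc n)))\<^sup>2)) sums area_functional r f"
    by simp
  then show ?thesis
    using sums_Suc_iff[of "\<lambda>n. pi * (real n * r ^ (2 * n) * (norm (c n))\<^sup>2)"] by simp
qed

section \<open>Series with gaps\<close>

text \<open>With \<open>x = m * k + p\<close>, passing from \<open>k\<close> to \<open>k + 1\<close>
  does not increase the weight when \<open>r ^ (2 * m) <= x / (x + m)\<close>, and does not decrease
  it under the reverse inequality. Since \<open>x / (x + m)\<close> increases with \<open>x\<close>,
  the upper condition at \<open>k = s\<close> covers all later steps, and the lower one at
  \<open>k = s - 1\<close> covers all earlier steps. For \<open>s = 0\<close> there are no earlier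
  steps.\<close>

lemma gap_weight_le:
  fixes s m p n :: nat and r :: real
  assumes "m \<ge> 1" "r \<ge> 0"
    and lower: "s \<ge> 1 \<Longrightarrow>
      (real m * (real s - 1) + real p) / (real m * real s + real p) \<le> r ^ (2 * m)"
    and upper: "r ^ (2 * m) \<le> (real m * real s + real p) / (real m * (real s + 1) + real p)"
  shows "real (m * n + p) * r ^ (2 * (m * n + p)) \<le> real (m * s + p) * r ^ (2 * (m * s + p))"
proof -
  define w where "w n = real (m * n + p) * r ^ (2 * (m * n + p))" for n
  have Suc: "w (Suc n) = (real (m * n + p) + real m) * r ^ (2 * m) * r ^ (2 * (m * n + p))" for n
    by (simp add: w_def power_add algebra_simps)
  have pos: "real (m * n + p) + real m > 0" for n
    using assms(1) by (simp add: add_nonneg_pos)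
  have mono_ratio: "x / (x + real m) \<le> y / (y + real m)" if "0 \<le> x" "x \<le> y" for x y
    using that assms(1) by (simp add: divide_simps algebra_simps)
  have down: "w (Suc k) \<le> w k" if "s \<le> k" for k
  proof -
    have "r ^ (2 * m) \<le> real (m * s + p) / (real (m * s + p) + real m)"
      using upper by (simp add: algebra_simps)
    also have "\<dots> \<le> real (m * k + p) / (real (m * k + p) + real m)"
      using that by (intro mono_ratio) (auto intro: mult_left_mono)
    finally have "(real (m * k + p) + real m) * r ^ (2 * m) \<le> real (m * k + p)"
      using pos[of k] by (simp add: field_simps)
    then show ?thesis
      unfolding Suc unfolding w_def using assms(2) by (intro mult_right_mono) auto
  qed
  have up: "w k \<le> w (Suc k)" if "Suc k \<le> s" for k
  proof -
    obtain s' where s': "s = Suc s'"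
      using Suc_le_D[OF \<open>Suc k \<le> s\<close>] by blast
    have "real (m * k + p) / (real (m * k + p) + real m)
        \<le> real (m * s' + p) / (real (m * s' + p) + real m)"
      using that s' by (intro mono_ratio) (auto intro: mult_left_mono)
    also have "\<dots> \<le> r ^ (2 * m)"
      using lower s' by (simp add: algebra_simps)
    finally have "real (m * k + p) \<le> (real (m * k + p) + real m) * r ^ (2 * m)"
      using pos[of k] by (simp add: field_simps)
    then show ?thesis
      unfolding Suc unfolding w_def using assms(2) by (intro mult_right_mono) auto
  qed
  have "w n \<le> w s"
  proof (cases "n \<le> s")
    case True
    then show ?thesis
    proof (induction rule: inc_induct)
      case (step k)
      then show ?case
        using up[of k] by simp
    qed simp
  next
    case False
    then have "s \<le> n" by simp
    then show ?thesis
    proof (induction rule: dec_induct)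
      case (step k)
      then show ?case
        using down[of k] by simp
    qed simp
  qed
  then show ?thesis
    unfolding w_def .
qed

lemma norm_le_sup_norm_disk:
  assumes "bounded (f ` ball 0 1)" "norm z < 1"
  shows "norm (f z) \<le> sup_norm_disk f"
  unfolding sup_norm_disk_def
  by (rule cSUP_upper) (use assms in \<open>auto simp: bounded_iff bdd_above_def\<close>)

text \<open>Filling the gaps with zeros gives an ordinary power series, the form to which the disk
  integrals apply. As \<open>m >= 1\<close>, the exponents increase strictly, so the reindexing
  preserves the sum.\<close>

lemma bounded_gap_analytic_coeffs:
  assumes "bounded_gap_analytic m p f" "m \<ge> 1"
  obtains c where "\<And>z. norm z < 1 \<Longrightarrow> (\<lambda>n. c n * z ^ n) sums f z"
    and "\<And>n. c n \<noteq> 0 \<Longrightarrow> \<exists>k. n = m * k + p"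
proof -
  obtain a where a: "\<forall>z\<in>ball 0 1. (\<lambda>n. a (m * n + p) * z ^ (m * n + p)) sums f z"
    using assms(1) unfolding bounded_gap_analytic_def by blast
  \<comment> \<open>The values of \<open>a\<close> off the progression are arbitrary and must be
    replaced by 0.\<close>
  define c where "c n = (if n \<in> range (\<lambda>k. m * k + p) then a n else 0)" for n
  have mono: "strict_mono (\<lambda>k. m * k + p)"
    using assms(2) by (auto simp: strict_mono_def)
  have "(\<lambda>n. c n * z ^ n) sums f z" if "norm z < 1" for z
  proof -
    have "c (m * k + p) = a (m * k + p)" for k
      by (auto simp: c_def)
    then have "(\<lambda>k. c (m * k + p) * z ^ (m * k + p)) sums f z"
      using a that by simp
    then show ?thesis
      using sums_mono_reindex[OF mono, of "\<lambda>n. c n * z ^ n" "f z"] by (auto simp: c_def)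
  qed
  moreover have "\<exists>k. n = m * k + p" if "c n \<noteq> 0" for n
    using that by (auto simp: c_def split: if_splits)
  ultimately show ?thesis
    using that by blast
qed

section \<open>The extremal monomials\<close>

lemma sup_norm_disk_monomial: "sup_norm_disk (\<lambda>z. C * z ^ k) = norm C"
proof (rule antisym)
  let ?f = "\<lambda>z. C * z ^ k"
  have le: "norm (?f z) \<le> norm C" if "norm z < 1" for z
    using that by (auto simp: norm_mult norm_power intro!: mult_left_le power_le_one)
  then show "sup_norm_disk ?f \<le> norm C"
    unfolding sup_norm_disk_def by (intro cSUP_least) auto
  have bdd: "bounded (?f ` ball 0 1)"
    using le by (auto simp: bounded_iff intro!: exI[of _ "norm C"])
  \<comment> \<open>The lower bound for the supremum comes from the coefficient inequality applied
    to the monomial itself, whose only coefficient is \<open>C\<close>, instead of from points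
    approaching the circle.\<close>
  have "(\<Sum>n<Suc k. (norm (if n = k then C else 0))\<^sup>2) \<le> (sup_norm_disk ?f)\<^sup>2"
  proof (rule norm_bounded_imp_sum_coeffs_le)
    show "(\<lambda>n. (if n = k then C else 0) * z ^ n) sums ?f z" for z
      using sums_single[of k "\<lambda>n. C * z ^ n"] by (simp add: if_distrib if_distribR cong: if_cong)
  qed (rule norm_le_sup_norm_disk[OF bdd])
  then have "(norm C)\<^sup>2 \<le> (sup_norm_disk ?f)\<^sup>2"
    by (simp add: if_distrib cong: if_cong)
  moreover have "0 \<le> sup_norm_disk ?f"
    using order_trans[OF norm_ge_zero norm_le_sup_norm_disk[OF bdd, of 0]] by simp
  ultimately show "norm C \<le> sup_norm_disk ?f"
    by (rule power2_le_imp_le)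
qed

lemma area_functional_monomial:
  assumes "0 \<le> r" "r < 1"
  shows "area_functional r (\<lambda>z. C * z ^ k) = pi * real k * r ^ (2 * k) * (norm C)\<^sup>2"
proof -
  have "(\<lambda>n. (if n = k then C else 0) * z ^ n) sums (C * z ^ k)" for z
    using sums_single[of k "\<lambda>n. C * z ^ n"] by (simp add: if_distrib if_distribR cong: if_cong)
  from area_functional_sums[OF assms this]
  have "(\<lambda>n. if n = k then pi * (real n * r ^ (2 * n) * (norm C)\<^sup>2) else 0)
      sums area_functional r (\<lambda>z. C * z ^ k)"
    by (rule sums_cong[THEN iffD1, rotated]) auto
  from sums_unique2[OF this sums_single] show ?thesis
    by simp
qed

lemma bounded_gap_analytic_monomial:
  assumes "m \<ge> 1"
  shows "bounded_gap_analytic m p (\<lambda>z. C * z ^ (m * s + p))"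
  unfolding bounded_gap_analytic_def
proof (intro conjI exI[of _ "\<lambda>n. if n = m * s + p then C else 0"] ballI)
  show "bounded ((\<lambda>z. C * z ^ (m * s + p)) ` ball 0 1)"
    unfolding bounded_iff
    by (intro exI[of _ "norm C"])
      (auto simp: norm_mult norm_power intro!: mult_left_le power_le_one)
  fix z :: complex
  show "(\<lambda>n. (if m * n + p = m * s + p then C else 0) * z ^ (m * n + p)) sums (C * z ^ (m * s + p))"
    using assms sums_single[of s "\<lambda>n. C * z ^ (m * n + p)"]
    by (simp add: if_distrib if_distribR cong: if_cong)
qed (auto intro!: holomorphic_intros)

theorem theorem2:
  fixes s m p :: nat and r :: real
  assumes "m \<ge> 1" and "p \<le> m" and "r \<ge> 0"
    and "\<not> (s = 0 \<and> p = 0) \<Longrightarrow>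
           (real m * (real s - 1) + real p) / (real m * real s + real p) \<le> r ^ (2 * m)"
    and "r ^ (2 * m) \<le> (real m * real s + real p) / (real m * (real s + 1) + real p)"
  shows "(\<forall>f. bounded_gap_analytic m p f \<longrightarrow>
            area_functional r f
              \<le> pi * real (m * s + p) * r ^ (2 * (m * s + p)) * (sup_norm_disk f)\<^sup>2) \<and>
         (\<forall>C :: complex. bounded_gap_analytic m p (\<lambda>z. C * z ^ (m * s + p)) \<and>
            area_functional r (\<lambda>z. C * z ^ (m * s + p))
              = pi * real (m * s + p) * r ^ (2 * (m * s + p))
                  * (sup_norm_disk (\<lambda>z. C * z ^ (m * s + p)))\<^sup>2)"
proof (intro conjI allI impI)
  \<comment> \<open>The upper condition on \<open>r ^ (2 * m)\<close> forces \<open>r < 1\<close>,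
    as the area series requires.\<close>
  have "(real m * real s + real p) / (real m * (real s + 1) + real p) < 1"
    using assms(1) by (simp add: divide_simps algebra_simps add_pos_nonneg add_nonneg_pos)
  with assms(5) have "r ^ (2 * m) < 1"
    by linarith
  then have r: "r < 1"
    by (meson not_less one_le_power)
  fix C :: complex
  show "bounded_gap_analytic m p (\<lambda>z. C * z ^ (m * s + p))"
    by (rule bounded_gap_analytic_monomial[OF assms(1)])
  show "area_functional r (\<lambda>z. C * z ^ (m * s + p))
      = pi * real (m * s + p) * r ^ (2 * (m * s + p))
          * (sup_norm_disk (\<lambda>z. C * z ^ (m * s + p)))\<^sup>2"
    by (simp only: area_functional_monomial[OF assms(3) r] sup_norm_disk_monomial)
  fix f
  assume f: "bounded_gap_analytic m p f"
  obtain c where c: "\<And>z. norm z < 1 \<Longrightarrow> (\<lambda>n. c n * z ^ n) sums f z"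
    and supp: "\<And>n. c n \<noteq> 0 \<Longrightarrow> \<exists>k. n = m * k + p"
    using bounded_gap_analytic_coeffs[OF f assms(1)] by blast
  \<comment> \<open>\<open>A\<close> is the largest weight among the occurring exponents; pulling it
    out of the area series leaves the sum of squared coefficients.\<close>
  define A where "A = real (m * s + p) * r ^ (2 * (m * s + p))"
  have "A \<ge> 0"
    using assms(3) by (simp add: A_def)
  have weight: "real n * r ^ (2 * n) * (norm (c n))\<^sup>2 \<le> A * (norm (c n))\<^sup>2" for n
  proof (cases "c n = 0")
    case False
    then obtain k where n: "n = m * k + p"
      using supp by blast
    have "real n * r ^ (2 * n) \<le> A"
      unfolding n A_def by (rule gap_weight_le) (use assms in auto)
    then show ?thesis
      by (rule mult_right_mono) simp
  qed simp
  have "bounded (f ` ball 0 1)"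
    using f by (simp add: bounded_gap_analytic_def)
  then have bessel: "(\<Sum>n<N. (norm (c n))\<^sup>2) \<le> (sup_norm_disk f)\<^sup>2" for N
    by (intro norm_bounded_imp_sum_coeffs_le[OF c] norm_le_sup_norm_disk)
  show "area_functional r f
      \<le> pi * real (m * s + p) * r ^ (2 * (m * s + p)) * (sup_norm_disk f)\<^sup>2"
  \<comment> \<open>It suffices to bound every partial sum, so the coefficient inequality is used
    only for finite sums.\<close>
  proof (rule LIMSEQ_le_const2[OF area_functional_sums[OF assms(3) r c, unfolded sums_def]])
    have "(\<Sum>n<N. pi * (real n * r ^ (2 * n) * (norm (c n))\<^sup>2))
        \<le> pi * real (m * s + p) * r ^ (2 * (m * s + p)) * (sup_norm_disk f)\<^sup>2" for N
    proof -
      have "(\<Sum>n<N. pi * (real n * r ^ (2 * n) * (norm (c n))\<^sup>2))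
          \<le> (\<Sum>n<N. pi * (A * (norm (c n))\<^sup>2))"
        by (intro sum_mono mult_left_mono weight) simp
      also have "\<dots> = pi * A * (\<Sum>n<N. (norm (c n))\<^sup>2)"
        by (simp add: sum_distrib_left mult_ac)
      also have "\<dots> \<le> pi * A * (sup_norm_disk f)\<^sup>2"
        using \<open>A \<ge> 0\<close> by (intro mult_left_mono bessel) simp
      finally show ?thesis
        by (simp add: A_def mult_ac)
    qed
    then show "\<exists>N. \<forall>n\<ge>N. (\<Sum>n<n. pi * (real n * r ^ (2 * n) * (norm (c n))\<^sup>2))
        \<le> pi * real (m * s + p) * r ^ (2 * (m * s + p)) * (sup_norm_disk f)\<^sup>2"
      by blast
  qed
qed

end
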